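(* Let $D$ be a non-zero $n\times n$ generalized Euclidean distance matrix, and let $P=I-\frac{1}{n}\mathbf{1}\mathbf{1}'$. Then $-PD^{\dagger}P$ is positive semidefinite (in particular symmetric).
   Context: All matrices are real; a prime denotes transpose. $\mathbf{1}\in\mathbb{R}^n$ is the vector of all ones, $I$ is the $n\times n$ identity matrix, and $D^\dagger$ is the Moore-Penrose inverse of $D$. A matrix is positive semidefinite if it is symmetric with nonnegative quadratic form. An $n\times n$ real symmetric matrix $L$ is a generalized Laplacian matrix if $L$ is positive semidefinite and $L\mathbf{1}=0$. An $n\times n$ matrix $D=[d_{ij}]$ is a generalized Euclidean distance matrix if there exist real numbers $a,b>0$ and an $n\times n$ generalized Laplacian matrix $L=[l_{ij}]$ such that $d_{ij}=a^2 l_{ii}+b^2 l_{jj}-2ab\,l_{ij}$ for all $i,j$. (Such a $D$ need not be symmetric.) *)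

theory Defs
  imports "HOL-Analysis.Analysis"
begin

definition psd_matrix :: "real ^ 'n ^ 'n \<Rightarrow> bool" where
  "psd_matrix A \<longleftrightarrow> transpose A = A \<and> (\<forall>x. 0 \<le> x \<bullet> (A *v x))"

text \<open>In the type \<^typ>\<open>real ^ 'n\<close>, the constant \<open>1\<close> is the vector of all ones.\<close>

definition generalized_laplacian :: "real ^ 'n ^ 'n \<Rightarrow> bool" where
  "generalized_laplacian L \<longleftrightarrow> psd_matrix L \<and> L *v 1 = 0"

definition generalized_edm :: "real ^ 'n ^ 'n \<Rightarrow> bool" where
  "generalized_edm D \<longleftrightarrow>
     (\<exists>a b L. 0 < a \<and> 0 < b \<and> generalized_laplacian L \<and>
       (\<forall>i j. D $ i $ j = a\<^sup>2 * L $ i $ i + b\<^sup>2 * L $ j $ j - 2 * a * b * L $ i $ j))"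

definition is_moore_penrose_inverse :: "real ^ 'n ^ 'm \<Rightarrow> real ^ 'm ^ 'n \<Rightarrow> bool" where
  "is_moore_penrose_inverse A X \<longleftrightarrow>
     A ** X ** A = A \<and> X ** A ** X = X \<and>
     transpose (A ** X) = A ** X \<and> transpose (X ** A) = X ** A"

definition moore_penrose_inverse :: "real ^ 'n ^ 'm \<Rightarrow> real ^ 'm ^ 'n" where
  "moore_penrose_inverse A = (THE X. is_moore_penrose_inverse A X)"

text \<open>The definite description is well defined: the four Penrose conditions have exactly one
  solution.\<close>

lemma moore_penrose_inverse_unique:
  assumes "is_moore_penrose_inverse A X" "is_moore_penrose_inverse A Y"
  shows "X = Y"
proof -
  have X: "A ** X ** A = A" "X ** A ** X = X"
    "transpose (A ** X) = A ** X" "transpose (X ** A) = X ** A"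
    and Y: "A ** Y ** A = A" "Y ** A ** Y = Y"
    "transpose (A ** Y) = A ** Y" "transpose (Y ** A) = Y ** A"
    using assms by (auto simp: is_moore_penrose_inverse_def)
  have "A ** X = transpose (A ** Y ** (A ** X))"
    by (metis X(3) Y(1) matrix_mul_assoc)
  also have "\<dots> = A ** X ** (A ** Y)"
    by (simp only: matrix_transpose_mul[of "A ** Y"] X(3) Y(3))
  also have "\<dots> = A ** Y"
    by (simp only: matrix_mul_assoc X(1))
  finally have AX: "A ** X = A ** Y" .
  have "X ** A = transpose (X ** A ** (Y ** A))"
    by (metis X(4) Y(1) matrix_mul_assoc)
  also have "\<dots> = Y ** A ** (X ** A)"
    by (simp only: matrix_transpose_mul[of "X ** A"] X(4) Y(4))
  also have "\<dots> = Y ** A"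
    by (metis X(1) matrix_mul_assoc)
  finally have XA: "X ** A = Y ** A" .
  show ?thesis
    by (metis AX XA X(2) Y(2) matrix_mul_assoc)
qed

lemma generalized_inverse_exists:
  fixes A :: "real ^ 'n ^ 'm"
  obtains G :: "real ^ 'm ^ 'n" where "A ** G ** A = A"
proof -
  obtain g where g: "linear g" "\<And>v. v \<in> range ((*v) A) \<Longrightarrow> A *v g v = v"
    using linear_exists_right_inverse_on[of "(*v) A" UNIV] by auto
  have "A ** matrix g ** A = A"
    using g by (simp add: matrix_eq flip: matrix_vector_mul_assoc)
  then show ?thesis by (rule that)
qed

lemma matrix_diff_ldistrib:
  fixes A :: "real ^ 'n ^ 'm"
  shows "A ** (B - C) = A ** B - A ** C"
  by (simp add: matrix_matrix_mult_def vec_eq_iff right_diff_distrib sum_subtractf)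

lemma transpose_mult_self_eq_0:
  fixes B :: "real ^ 'n ^ 'm"
  assumes "transpose B ** B = 0"
  shows "B = 0"
proof -
  have "(B *v x) \<bullet> (B *v x) = 0" for x
  proof -
    have "(B *v x) \<bullet> (B *v x) = x \<bullet> ((transpose B ** B) *v x)"
      by (metis dot_lmul_matrix inner_commute matrix_vector_mul_assoc vector_transpose_matrix
          transpose_matrix_vector)
    then show ?thesis by (simp add: assms)
  qed
  then show ?thesis by (simp add: matrix_eq)
qed

lemma least_squares_inverse_exists:
  fixes A :: "real ^ 'n ^ 'm"
  obtains Y where "A ** Y ** A = A" "transpose (A ** Y) = A ** Y"
proof -
  let ?A' = "transpose A"
  have cancel: "A ** G ** ?A' ** A = A" if G: "?A' ** A ** G ** (?A' ** A) = ?A' ** A" for G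
  proof -
    define B where "B = A ** (G ** ?A' ** A - mat 1)"
    have B: "B = A ** G ** ?A' ** A - A"
      by (simp add: B_def matrix_diff_ldistrib matrix_mul_assoc)
    have "?A' ** B = 0"
      using G by (simp add: B matrix_diff_ldistrib matrix_mul_assoc)
    then have "transpose B ** B = 0"
      by (metis B_def matrix_transpose_mul matrix_mul_assoc times0_right)
    then show ?thesis
      using transpose_mult_self_eq_0 B by fastforce
  qed
  obtain G where G: "?A' ** A ** G ** (?A' ** A) = ?A' ** A"
    by (rule generalized_inverse_exists)
  have "transpose (?A' ** A ** G ** (?A' ** A)) = transpose (?A' ** A)"
    using G by simp
  then have "?A' ** A ** transpose G ** (?A' ** A) = ?A' ** A"
    by (simp add: matrix_transpose_mul matrix_mul_assoc)
  then have "transpose (A ** transpose G ** ?A' ** A) = ?A'"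
    using cancel by simp
  then have A': "?A' ** (A ** G ** ?A') = ?A'"
    by (simp add: matrix_transpose_mul matrix_mul_assoc)
  let ?W = "A ** G ** ?A'"
  have W': "transpose ?W = A ** transpose G ** ?A'"
    by (simp add: matrix_transpose_mul matrix_mul_assoc)
  have WW: "transpose ?W ** ?W = transpose ?W"
    unfolding W' using A' by (metis matrix_mul_assoc)
  have "transpose (transpose ?W ** ?W) = transpose ?W ** ?W"
    by (simp only: matrix_transpose_mul[of "transpose ?W"] transpose_transpose)
  then have "transpose ?W = ?W"
    by (simp only: WW transpose_transpose)
  with cancel[OF G] show ?thesis
    by (intro that[of "G ** ?A'"]) (simp_all add: matrix_mul_assoc)
qed

lemma moore_penrose_inverse_exists: "\<exists>X. is_moore_penrose_inverse A X"
proof -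
  obtain Y where Y: "A ** Y ** A = A" "transpose (A ** Y) = A ** Y"
    by (rule least_squares_inverse_exists)
  obtain V where V: "transpose A ** V ** transpose A = transpose A"
    "transpose (transpose A ** V) = transpose A ** V"
    by (rule least_squares_inverse_exists)
  define Z where "Z = transpose V"
  have Z: "A ** Z ** A = A" "transpose (Z ** A) = Z ** A"
    using arg_cong[OF V(1), of transpose] V(2)
    by (simp_all add: Z_def matrix_transpose_mul matrix_mul_assoc)
  have AX: "A ** (Z ** A ** Y) = A ** Y" and XA: "Z ** A ** Y ** A = Z ** A"
    using Y(1) Z(1) by (metis matrix_mul_assoc)+
  have "is_moore_penrose_inverse A (Z ** A ** Y)"
    unfolding is_moore_penrose_inverse_def AX XA
    using Y Z by (metis AX matrix_mul_assoc)
  then show ?thesis ..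
qed

lemma is_moore_penrose_inverse_moore_penrose_inverse:
  "is_moore_penrose_inverse A (moore_penrose_inverse A)"
  unfolding moore_penrose_inverse_def
  by (rule theI') (use moore_penrose_inverse_exists moore_penrose_inverse_unique in blast)

end

theory Submission
  imports Defs
begin

text \<open>Let \<open>\<ell>\<close> be the diagonal of \<open>L\<close>, so that
  \<open>D = a\<^sup>2 \<ell> 1' + b\<^sup>2 1 \<ell>' - 2ab L\<close>. If \<open>1'Du = 0\<close>, then \<open>\<ell>'u\<close> is a fixed nonpositive multiple
  of \<open>1'u\<close>; hence the form \<open>v'Du\<close> is symmetric and negative semidefinite on the space of all such
  vectors. It follows that \<open>D\<close> and its transpose have the same kernel, which is orthogonal to
  \<open>1\<close>. Thus \<open>D\<close> commutes with its Moore-Penrose inverse \<open>X\<close>, and the projection \<open>DX = XD\<close> fixes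
  \<open>1\<close>. For \<open>x, y\<close> orthogonal to \<open>1\<close>, with \<open>v = Xx\<close> and \<open>u = Xy\<close>, we obtain
  \<open>x'Xy = (Dv)'u\<close> and \<open>1'Du = 1'Dv = 0\<close>.\<close>

lemma inner_matrix_vector_transpose:
  fixes A :: "real ^ 'n ^ 'm"
  shows "x \<bullet> (A *v y) = y \<bullet> (transpose A *v x)"
  by (metis dot_lmul_matrix inner_commute transpose_matrix_vector)

lemma transpose_eq_self_iff:
  fixes A :: "real ^ 'n ^ 'n"
  shows "transpose A = A \<longleftrightarrow> (\<forall>x y. x \<bullet> (A *v y) = y \<bullet> (A *v x))"
proof
  assume "\<forall>x y. x \<bullet> (A *v y) = y \<bullet> (A *v x)"
  then have "y \<bullet> (transpose A *v x) = y \<bullet> (A *v x)" for x y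
    by (metis inner_matrix_vector_transpose)
  then show "transpose A = A"
    unfolding matrix_eq by (metis vector_eq_ldot)
qed (metis inner_matrix_vector_transpose)

text \<open>Moving from \<open>x\<close> along \<open>A *v x\<close> changes the form to first order
  by a multiple of the squared norm of \<open>A *v x\<close>, so a nonzero \<open>A *v x\<close>
  would give the form a negative value.\<close>

lemma psd_matrix_kernel:
  assumes "psd_matrix A" and "x \<bullet> (A *v x) = 0"
  shows "A *v x = 0"
proof -
  define y where "y = A *v x"
  define c where "c = y \<bullet> y"
  define q where "q = y \<bullet> (A *v y)"
  \<comment> \<open>The denominator \<open>q + 1\<close> stays positive when \<open>q = 0\<close>,
    and the form at \<open>x + t *\<^sub>R y\<close> still becomes a negative multiple of
    \<open>c\<^sup>2\<close>.\<close>
  define t where "t = - c / (q + 1)"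
  have "0 \<le> q"
    using assms(1) by (simp add: q_def psd_matrix_def)
  have "x \<bullet> (A *v y) = c"
    using assms(1) unfolding c_def y_def psd_matrix_def transpose_eq_self_iff by blast
  then have "(x + t *\<^sub>R y) \<bullet> (A *v (x + t *\<^sub>R y)) = 2 * t * c + t\<^sup>2 * q"
    using assms(2)
    by (simp add: matrix_vector_right_distrib matrix_vector_mult_scaleR inner_add_left
        inner_add_right power2_eq_square algebra_simps flip: y_def c_def q_def)
  then have "0 \<le> 2 * t * c + t\<^sup>2 * q"
    using assms(1) by (metis psd_matrix_def)
  also have "2 * t * c + t\<^sup>2 * q = - (c\<^sup>2 * (q + 2) / (q + 1)\<^sup>2)"
    using \<open>0 \<le> q\<close> by (simp add: t_def divide_simps power2_eq_square) (simp add: algebra_simps)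
  finally have "c\<^sup>2 * (q + 2) / (q + 1)\<^sup>2 \<le> 0"
    by simp
  then have "c = 0"
    using \<open>0 \<le> q\<close> by (simp add: divide_le_0_iff mult_le_0_iff)
  then show ?thesis
    by (simp add: c_def y_def)
qed

lemma psd_matrix_diagonal_nonneg: "psd_matrix A \<Longrightarrow> 0 \<le> A $ i $ i"
  by (metis cart_eq_inner_axis inner_commute matrix_vector_mul_component matrix_vector_mult_basis
      column_def psd_matrix_def vec_lambda_beta)

text \<open>Each diagonal entry is the form at a basis vector, so \<open>psd_matrix_kernel\<close>
  annihilates every column.\<close>

lemma psd_matrix_diagonal_eq_0:
  assumes "psd_matrix A" and "\<And>i. A $ i $ i = 0"
  shows "A = 0"
proof -
  have "A *v axis i 1 = 0" for i
    using assms(2)[of i]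
    by (intro psd_matrix_kernel[OF assms(1)])
      (simp add: matrix_vector_mult_basis column_def inner_axis')
  then show ?thesis
    by (simp add: matrix_vector_mult_basis column_def vec_eq_iff)
qed

text \<open>\<open>D\<close> enters only through its bilinear form, whose shape survives transposing
  \<open>D\<close> while exchanging \<open>a\<close> and \<open>b\<close>. In the application
  \<open>l\<close> is the diagonal of \<open>L\<close>, and its positive sum encodes
  \<open>D \<noteq> 0\<close>.\<close>

locale nonzero_edm =
  fixes D L :: "real ^ 'n ^ 'n" and l :: "real ^ 'n" and a b :: real
  assumes a_pos: "0 < a" and b_pos: "0 < b"
    and psd: "psd_matrix L" and L_one: "L *v 1 = 0"
    and trace_pos: "0 < 1 \<bullet> l"
    and form: "v \<bullet> (D *v u) =
      a\<^sup>2 * (v \<bullet> l) * (1 \<bullet> u) + b\<^sup>2 * (1 \<bullet> v) * (l \<bullet> u) - 2 * a * b * (v \<bullet> (L *v u))"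
begin

text \<open>Solving \<open>1'Du = 0\<close> for \<open>l'u\<close> produces this constant, since the
  term in \<open>L\<close> drops out of \<open>1'Du\<close>.\<close>

definition k :: real where
  "k = a\<^sup>2 * (1 \<bullet> l) / (b\<^sup>2 * real CARD('n))"

lemma k_pos: "0 < k"
  using a_pos b_pos trace_pos by (simp add: k_def)

lemma L_symmetric: "x \<bullet> (L *v y) = y \<bullet> (L *v x)"
  using psd unfolding psd_matrix_def transpose_eq_self_iff by blast

lemma balanced_iff: "1 \<bullet> (D *v u) = 0 \<longleftrightarrow> l \<bullet> u = - k * (1 \<bullet> u)"
proof -
  have "(1 :: real ^ 'n) \<bullet> 1 = real CARD('n)"
    by (simp add: inner_vec_def)
  moreover have "1 \<bullet> (L *v u) = 0"
    using L_symmetric[of 1 u] by (simp add: L_one)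
  ultimately have "1 \<bullet> (D *v u) = a\<^sup>2 * (1 \<bullet> l) * (1 \<bullet> u) + b\<^sup>2 * real CARD('n) * (l \<bullet> u)"
    by (simp add: form)
  then show ?thesis
    using b_pos by (simp add: k_def field_simps) argo
qed

text \<open>Eliminating \<open>l\<close> turns both rank-one terms into multiples of
  \<open>(1 \<bullet> u) * (1 \<bullet> v)\<close>, which leaves an expression symmetric in
  \<open>u\<close> and \<open>v\<close>.\<close>

lemma balanced_form:
  assumes "1 \<bullet> (D *v u) = 0" and "1 \<bullet> (D *v v) = 0"
  shows "v \<bullet> (D *v u) =
    - ((a\<^sup>2 + b\<^sup>2) * k * (1 \<bullet> u) * (1 \<bullet> v)) - 2 * a * b * (v \<bullet> (L *v u))"
proof -
  have "l \<bullet> u = - k * (1 \<bullet> u)" and "v \<bullet> l = - k * (1 \<bullet> v)"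
    using assms by (simp_all add: balanced_iff inner_commute[of v l])
  then show ?thesis
    unfolding form by (simp only:) (simp add: algebra_simps)
qed

lemma balanced_nonpos:
  assumes "1 \<bullet> (D *v u) = 0"
  shows "u \<bullet> (D *v u) \<le> 0"
proof -
  have "0 \<le> (a\<^sup>2 + b\<^sup>2) * k * (1 \<bullet> u)\<^sup>2" and "0 \<le> 2 * a * b * (u \<bullet> (L *v u))"
    using a_pos b_pos k_pos psd by (simp_all add: psd_matrix_def)
  then show ?thesis
    by (simp add: balanced_form[OF assms assms] power2_eq_square mult.assoc)
qed

text \<open>On the kernel the balanced form is a sum of two nonpositive terms equal to zero, so both
  vanish. The resulting description is free of \<open>a\<close> and \<open>b\<close>, hence the same
  for \<open>transpose D\<close>.\<close>

lemma kernel_iff: "D *v x = 0 \<longleftrightarrow> 1 \<bullet> x = 0 \<and> l \<bullet> x = 0 \<and> L *v x = 0"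
proof
  assume x: "D *v x = 0"
  then have bal: "1 \<bullet> (D *v x) = 0"
    by simp
  have "0 < (a\<^sup>2 + b\<^sup>2) * k" and "0 < 2 * a * b"
    using a_pos b_pos k_pos by (simp_all add: add_pos_pos)
  moreover have "(a\<^sup>2 + b\<^sup>2) * k * (1 \<bullet> x)\<^sup>2 + 2 * a * b * (x \<bullet> (L *v x)) = 0"
    using balanced_form[OF bal bal] by (simp add: x power2_eq_square mult.assoc)
  moreover have "0 \<le> x \<bullet> (L *v x)"
    using psd by (simp add: psd_matrix_def)
  ultimately have "(1 \<bullet> x)\<^sup>2 = 0" and "x \<bullet> (L *v x) = 0"
    by (smt (verit) mult_nonneg_nonneg mult_pos_pos zero_le_power2)+
  then show "1 \<bullet> x = 0 \<and> l \<bullet> x = 0 \<and> L *v x = 0"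
    using psd_matrix_kernel[OF psd] bal by (simp add: balanced_iff)
next
  assume "1 \<bullet> x = 0 \<and> l \<bullet> x = 0 \<and> L *v x = 0"
  then have "v \<bullet> (D *v x) = 0" for v
    by (simp add: form)
  then show "D *v x = 0"
    by (metis inner_eq_zero_iff)
qed

lemma nonzero_edm_transpose: "nonzero_edm (transpose D) L l b a"
proof
  fix u v
  have "v \<bullet> (transpose D *v u) = u \<bullet> (D *v v)"
    by (rule inner_matrix_vector_transpose[symmetric])
  then show "v \<bullet> (transpose D *v u) =
      b\<^sup>2 * (v \<bullet> l) * (1 \<bullet> u) + a\<^sup>2 * (1 \<bullet> v) * (l \<bullet> u) - 2 * b * a * (v \<bullet> (L *v u))"
    by (simp add: form L_symmetric[of u v] inner_commute algebra_simps)
qed (use a_pos b_pos psd L_one trace_pos in auto)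

lemma kernel_transpose_iff: "transpose D *v x = 0 \<longleftrightarrow> D *v x = 0"
  unfolding kernel_iff nonzero_edm.kernel_iff[OF nonzero_edm_transpose] ..

context
  fixes X :: "real ^ 'n ^ 'n"
  assumes X: "is_moore_penrose_inverse D X"
begin

text \<open>The range of \<open>I - XD\<close> lies in the kernel of \<open>D\<close>, hence of
  \<open>transpose D\<close>; transposing gives \<open>XDD = D\<close>. The range of
  \<open>I - DX\<close> lies in the kernel of \<open>transpose D\<close>, hence of \<open>D\<close>,
  so \<open>DDX = D\<close>. Thus \<open>XDDX\<close> equals both \<open>DX\<close> and
  \<open>XD\<close>.\<close>

lemma commute: "D ** X = X ** D"
proof -
  have DXD: "D ** X ** D = D" and F: "transpose (D ** X) = D ** X"
    and E: "transpose (X ** D) = X ** D"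
    using X by (auto simp: is_moore_penrose_inverse_def)
  have "D *v (x - (X ** D) *v x) = 0" for x
    using DXD by (simp add: matrix_vector_mult_diff_distrib matrix_vector_mul_assoc matrix_mul_assoc)
  then have "transpose D ** (X ** D) = transpose D"
    unfolding kernel_transpose_iff[symmetric]
    by (simp add: matrix_vector_mult_diff_distrib matrix_eq flip: matrix_vector_mul_assoc)
  then have "X ** D ** D = D"
    by (metis E matrix_transpose_mul transpose_transpose)
  then have EF: "X ** D ** (D ** X) = D ** X"
    by (simp add: matrix_mul_assoc)
  have "transpose D ** (D ** X) = transpose D"
    by (metis DXD F matrix_transpose_mul)
  then have "transpose D *v (x - (D ** X) *v x) = 0" for x
    by (simp add: matrix_vector_mult_diff_distrib matrix_vector_mul_assoc)
  then have "D ** (D ** X) = D"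
    unfolding kernel_transpose_iff
    by (simp add: matrix_vector_mult_diff_distrib matrix_eq flip: matrix_vector_mul_assoc)
  then have "X ** D ** (D ** X) = X ** D"
    by (metis matrix_mul_assoc)
  with EF show ?thesis
    by simp
qed

text \<open>The vector \<open>x - XDx\<close> lies in the kernel of \<open>D\<close>, which is
  orthogonal to \<open>1\<close>, and \<open>XD = DX\<close>.\<close>

lemma one_inner_range: "1 \<bullet> (D *v (X *v x)) = 1 \<bullet> x"
proof -
  have "D *v (x - (X ** D) *v x) = 0"
    using X by (simp add: is_moore_penrose_inverse_def matrix_vector_mult_diff_distrib
        matrix_vector_mul_assoc matrix_mul_assoc)
  then have "1 \<bullet> (x - (X ** D) *v x) = 0"
    by (simp add: kernel_iff)
  then show ?thesis
    by (simp add: inner_diff_right matrix_vector_mul_assoc commute)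
qed

text \<open>Since \<open>X = XDX = DXX\<close>, the symmetric factor \<open>DX\<close> can be moved
  onto \<open>x\<close>.\<close>

lemma inner_moore_penrose: "x \<bullet> (X *v y) = (X *v y) \<bullet> (D *v (X *v x))"
proof -
  have "transpose (D ** X) = D ** X" and "X ** D ** X = X"
    using X by (auto simp: is_moore_penrose_inverse_def)
  then show ?thesis
    by (metis commute inner_matrix_vector_transpose matrix_vector_mul_assoc)
qed

lemma inner_moore_penrose_commute:
  assumes "1 \<bullet> x = 0" and "1 \<bullet> y = 0"
  shows "x \<bullet> (X *v y) = y \<bullet> (X *v x)"
  using assms
  by (simp add: inner_moore_penrose balanced_form one_inner_range L_symmetric[of "X *v y" "X *v x"])

lemma inner_moore_penrose_nonpos: "1 \<bullet> x = 0 \<Longrightarrow> x \<bullet> (X *v x) \<le> 0"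
  by (simp add: inner_moore_penrose balanced_nonpos one_inner_range)

end

end

text \<open>\<open>L = 0\<close> would force \<open>D = 0\<close>; a nonzero positive semidefinite
  \<open>L\<close> has a positive diagonal entry, hence a positive trace.\<close>

lemma generalized_edm_imp_nonzero_edm:
  fixes D :: "real ^ 'n ^ 'n"
  assumes "generalized_edm D" and "D \<noteq> 0"
  obtains L l a b where "nonzero_edm D L l a b"
proof -
  obtain a b L where ab: "0 < a" "0 < b" and L: "psd_matrix L" "L *v 1 = 0"
    and D: "\<And>i j. D $ i $ j = a\<^sup>2 * L $ i $ i + b\<^sup>2 * L $ j $ j - 2 * a * b * L $ i $ j"
    using assms(1) unfolding generalized_edm_def generalized_laplacian_def by blast
  define l where "l = (\<chi> i. L $ i $ i)"
  have "D = 0" if "L = 0"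
    using that by (simp add: vec_eq_iff D)
  with assms(2) have "L \<noteq> 0"
    by blast
  then obtain i where "L $ i $ i \<noteq> 0"
    using psd_matrix_diagonal_eq_0[OF L(1)] by blast
  then have "0 < (\<Sum>i\<in>UNIV. L $ i $ i)"
    using psd_matrix_diagonal_nonneg[OF L(1)]
    by (intro sum_pos2[of _ i]) (auto simp: less_le)
  then have l: "0 < 1 \<bullet> l"
    by (simp add: l_def inner_vec_def)
  have "v \<bullet> (D *v u) =
      a\<^sup>2 * (v \<bullet> l) * (1 \<bullet> u) + b\<^sup>2 * (1 \<bullet> v) * (l \<bullet> u) - 2 * a * b * (v \<bullet> (L *v u))" for u v
  proof -
    have expand: "v \<bullet> (A *v u) = (\<Sum>i\<in>UNIV. \<Sum>j\<in>UNIV. v $ i * (A $ i $ j * u $ j))"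
      for A :: "real ^ 'n ^ 'n"
      by (simp add: inner_vec_def matrix_vector_mult_def sum_distrib_left)
    \<comment> \<open>In the first two terms the factors are grouped by index, so that their double
      sums split into products.\<close>
    have "v \<bullet> (D *v u) = (\<Sum>i\<in>UNIV. \<Sum>j\<in>UNIV. a\<^sup>2 * (v $ i * l $ i * u $ j)
        + b\<^sup>2 * (v $ i * (l $ j * u $ j)) - 2 * a * b * (v $ i * (L $ i $ j * u $ j)))"
      by (simp add: expand D l_def algebra_simps)
    also have "\<dots> = a\<^sup>2 * ((\<Sum>i\<in>UNIV. v $ i * l $ i) * (\<Sum>j\<in>UNIV. u $ j))
        + b\<^sup>2 * ((\<Sum>i\<in>UNIV. v $ i) * (\<Sum>j\<in>UNIV. l $ j * u $ j))
        - 2 * a * b * (\<Sum>i\<in>UNIV. \<Sum>j\<in>UNIV. v $ i * (L $ i $ j * u $ j))"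
      by (simp add: sum.distrib sum_subtractf sum_product flip: sum_distrib_left)
    finally show ?thesis
      unfolding expand[of L] by (simp add: inner_vec_def mult.assoc)
  qed
  then show ?thesis
    using ab L l by (intro that[of L l a b]) (simp add: nonzero_edm_def)
qed

theorem theorem2p13:
  fixes D P :: "real ^ 'n ^ 'n"
  assumes "generalized_edm D"
    and "D \<noteq> 0"
    and "P = mat 1 - (1 / real CARD('n)) *\<^sub>R
      ((columnvector 1 :: real ^ 1 ^ 'n) ** (rowvector 1 :: real ^ 'n ^ 1))"
  shows "psd_matrix (- (P ** moore_penrose_inverse D ** P))"
proof -
  define X where "X = moore_penrose_inverse D"
  obtain L l a b where "nonzero_edm D L l a b"
    using generalized_edm_imp_nonzero_edm[OF assms(1,2)] .
  then interpret nonzero_edm D L l a b .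
  note X = is_moore_penrose_inverse_moore_penrose_inverse[of D, folded X_def]
  have P: "P $ i $ j = (if i = j then 1 else 0) - 1 / real CARD('n)" for i j
    by (simp add: assms(3) mat_def matrix_matrix_mult_def columnvector_def rowvector_def)
  have P_sym: "transpose P = P"
    by (simp add: vec_eq_iff transpose_def P)
  have "P *v 1 = 0"
    by (simp add: vec_eq_iff matrix_vector_mult_def P sum_subtractf)
  \<comment> \<open>The range of \<open>P\<close> is orthogonal to \<open>1\<close>, which is where
    the form of \<open>X\<close> is known to be symmetric and nonpositive.\<close>
  then have P_one: "1 \<bullet> (P *v x) = 0" for x
    by (metis P_sym inner_matrix_vector_transpose inner_zero_right)
  have PXP: "x \<bullet> (- (P ** X ** P) *v y) = - ((P *v x) \<bullet> (X *v (P *v y)))" for x y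
  proof -
    have "x \<bullet> (P *v z) = (P *v x) \<bullet> z" for z
      by (metis P_sym inner_commute inner_matrix_vector_transpose)
    \<comment> \<open>The sign is pulled out of the matrix by reading it as a difference from
      \<open>0\<close>.\<close>
    moreover have "- (P ** X ** P) *v y = - (P *v (X *v (P *v y)))"
      using matrix_vector_mult_diff_rdistrib[of 0 "P ** X ** P" y]
      by (simp add: matrix_vector_mul_assoc matrix_mul_assoc)
    ultimately show ?thesis
      by simp
  qed
  have "psd_matrix (- (P ** X ** P))"
    unfolding psd_matrix_def transpose_eq_self_iff PXP
    using inner_moore_penrose_commute[OF X P_one P_one] inner_moore_penrose_nonpos[OF X P_one]
    by simp
  then show ?thesis
    by (simp only: X_def)
qed

end
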